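(* Let $n\geq1$. Any subalgebra $A$ of $\mathcal M([0,1]^n)$ which is generated by $n$ elements and is separating (for all $x\neq y$ in $[0,1]^n$ there is $f\in A$ with $f(x)\neq f(y)$) coincides with $\mathcal M([0,1]^n)$. Equivalently, any $n$-generator epi-subalgebra of $\mathcal M([0,1]^n)$ coincides with $\mathcal M([0,1]^n)$.
   Context: A McNaughton function on $[0,1]^n$ is a continuous function $f\colon[0,1]^n\to[0,1]$ for which there are finitely many affine functions with integer coefficients $p_1,\ldots,p_m$ such that for every $x$ there is $j$ with $f(x)=p_j(x)$. $\mathcal M([0,1]^n)$ is the MV-algebra of all McNaughton functions on $[0,1]^n$ with pointwise operations $f\oplus g=\min(1,f+g)$, $\neg f=1-f$, $0$ the zero function. A subalgebra $A$ is an epi-subalgebra if any two MV-homomorphisms from $\mathcal M([0,1]^n)$ to an MV-algebra that agree on $A$ are equal. *)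

theory Defs
  imports "HOL-Analysis.Analysis" "HOL-Algebra.Congruence"
begin

record 'a mv_struct = "'a partial_object" +
  mv_plus :: "'a \<Rightarrow> 'a \<Rightarrow> 'a" (infixl "\<oplus>\<index>" 65)
  mv_neg :: "'a \<Rightarrow> 'a" ("\<sim>\<index> _" [81] 80)
  mv_zero :: 'a ("\<zero>\<index>")

locale mv_algebra =
  fixes B :: "'a mv_struct" (structure)
  assumes plus_closed: "\<lbrakk>x \<in> carrier B; y \<in> carrier B\<rbrakk> \<Longrightarrow> x \<oplus> y \<in> carrier B"
    and neg_closed: "x \<in> carrier B \<Longrightarrow> \<sim> x \<in> carrier B"
    and zero_closed: "\<zero> \<in> carrier B"
    and plus_assoc:
      "\<lbrakk>x \<in> carrier B; y \<in> carrier B; z \<in> carrier B\<rbrakk> \<Longrightarrow> (x \<oplus> y) \<oplus> z = x \<oplus> (y \<oplus> z)"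
    and plus_comm: "\<lbrakk>x \<in> carrier B; y \<in> carrier B\<rbrakk> \<Longrightarrow> x \<oplus> y = y \<oplus> x"
    and plus_zero: "x \<in> carrier B \<Longrightarrow> x \<oplus> \<zero> = x"
    and neg_neg: "x \<in> carrier B \<Longrightarrow> \<sim> (\<sim> x) = x"
    and plus_one: "x \<in> carrier B \<Longrightarrow> x \<oplus> \<sim> \<zero> = \<sim> \<zero>"
    and lukasiewicz:
      "\<lbrakk>x \<in> carrier B; y \<in> carrier B\<rbrakk> \<Longrightarrow> \<sim> (\<sim> x \<oplus> y) \<oplus> y = \<sim> (\<sim> y \<oplus> x) \<oplus> x"

definition mv_hom :: "'a mv_struct \<Rightarrow> 'b mv_struct \<Rightarrow> ('a \<Rightarrow> 'b) set" where
  "mv_hom B C = {h \<in> carrier B \<rightarrow> carrier C.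
     h \<zero>\<^bsub>B\<^esub> = \<zero>\<^bsub>C\<^esub> \<and>
     (\<forall>x\<in>carrier B. h (\<sim>\<^bsub>B\<^esub> x) = \<sim>\<^bsub>C\<^esub> (h x)) \<and>
     (\<forall>x\<in>carrier B. \<forall>y\<in>carrier B. h (x \<oplus>\<^bsub>B\<^esub> y) = h x \<oplus>\<^bsub>C\<^esub> h y)}"

definition mv_subalgebra :: "'a set \<Rightarrow> 'a mv_struct \<Rightarrow> bool" where
  "mv_subalgebra A B \<longleftrightarrow> A \<subseteq> carrier B \<and> \<zero>\<^bsub>B\<^esub> \<in> A \<and>
     (\<forall>x\<in>A. \<sim>\<^bsub>B\<^esub> x \<in> A) \<and> (\<forall>x\<in>A. \<forall>y\<in>A. x \<oplus>\<^bsub>B\<^esub> y \<in> A)"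

definition mv_generated :: "'a mv_struct \<Rightarrow> 'a set \<Rightarrow> 'a set" where
  "mv_generated B G = \<Inter>{A. mv_subalgebra A B \<and> G \<subseteq> A}"

text \<open>The bound is an inequality because the k generators may be listed with repetitions.\<close>

definition mv_generated_by_n :: "'a mv_struct \<Rightarrow> nat \<Rightarrow> 'a set \<Rightarrow> bool" where
  "mv_generated_by_n B k A \<longleftrightarrow>
     (\<exists>G. G \<subseteq> carrier B \<and> finite G \<and> card G \<le> k \<and> A = mv_generated B G)"

text \<open>HOL cannot quantify over types inside a formula, so the type \<open>'b\<close> carrying the test
  algebras is a parameter. Any two homomorphisms from \<open>B\<close> take their values in the subalgebra
  generated by the union of their two images. For countable \<open>B\<close> (such as the algebra of McNaughton
  functions) that subalgebra is countable and has an isomorphic copy on every infinite type;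
  so for countable \<open>B\<close> and infinite \<open>'b\<close> the predicate does not depend on \<open>'b\<close> and it
  expresses agreement for all MV-algebras whatsoever.\<close>

definition mv_epi_subalgebra :: "'b itself \<Rightarrow> 'a set \<Rightarrow> 'a mv_struct \<Rightarrow> bool" where
  "mv_epi_subalgebra (T :: 'b itself) A B \<longleftrightarrow> mv_subalgebra A B \<and>
     (\<forall>C :: 'b mv_struct. mv_algebra C \<longrightarrow>
       (\<forall>h\<in>mv_hom B C. \<forall>k\<in>mv_hom B C.
          (\<forall>a\<in>A. h a = k a) \<longrightarrow> (\<forall>b\<in>carrier B. h b = k b)))"

abbreviation unit_cube :: "(real ^ 'n) set" where
  "unit_cube \<equiv> cbox 0 1"

definition integer_affine :: "(real ^ 'n \<Rightarrow> real) \<Rightarrow> bool" where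
  "integer_affine p \<longleftrightarrow>
     (\<exists>(a :: int ^ 'n) (b :: int). \<forall>x. p x = (\<Sum>i\<in>UNIV. of_int (a $ i) * x $ i) + of_int b)"

text \<open>Functions on the cube are represented extensionally, i.e. with the value \<open>undefined\<close>
  outside the cube, so that equality in HOL is equality of functions on the cube.\<close>

definition mcnaughton_function :: "(real ^ 'n \<Rightarrow> real) \<Rightarrow> bool" where
  "mcnaughton_function f \<longleftrightarrow> f \<in> unit_cube \<rightarrow>\<^sub>E {0..1} \<and> continuous_on unit_cube f \<and>
     (\<exists>P. finite P \<and> (\<forall>p\<in>P. integer_affine p) \<and> (\<forall>x\<in>unit_cube. \<exists>p\<in>P. f x = p x))"

definition mcnaughton_algebra :: "(real ^ 'n \<Rightarrow> real) mv_struct" where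
  "mcnaughton_algebra =
     \<lparr>carrier = {f. mcnaughton_function f},
      mv_plus = (\<lambda>f g. \<lambda>x\<in>unit_cube. min 1 (f x + g x)),
      mv_neg = (\<lambda>f. \<lambda>x\<in>unit_cube. 1 - f x),
      mv_zero = (\<lambda>x\<in>unit_cube. 0)\<rparr>"

definition separating :: "(real ^ 'n \<Rightarrow> real) set \<Rightarrow> bool" where
  "separating A \<longleftrightarrow> (\<forall>x\<in>unit_cube. \<forall>y\<in>unit_cube. x \<noteq> y \<longrightarrow> (\<exists>f\<in>A. f x \<noteq> f y))"

lemma integer_affine_const: "integer_affine (\<lambda>_. of_int c)"
  unfolding integer_affine_def by (rule exI[of _ 0], rule exI[of _ c]) simp

lemma integer_affine_add:
  assumes "integer_affine p" "integer_affine q"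
  shows "integer_affine (\<lambda>x. p x + q x)"
proof -
  obtain a b c d where
    "\<And>x. p x = (\<Sum>i\<in>UNIV. of_int (a $ i) * x $ i) + of_int b"
    "\<And>x. q x = (\<Sum>i\<in>UNIV. of_int (c $ i) * x $ i) + of_int d"
    using assms unfolding integer_affine_def by blast
  then show ?thesis unfolding integer_affine_def
    by (intro exI[of _ "a + c"] exI[of _ "b + d"])
      (simp add: algebra_simps sum.distrib)
qed

lemma integer_affine_neg:
  assumes "integer_affine p"
  shows "integer_affine (\<lambda>x. 1 - p x)"
proof -
  obtain a b where "\<And>x. p x = (\<Sum>i\<in>UNIV. of_int (a $ i) * x $ i) + of_int b"
    using assms unfolding integer_affine_def by blast
  then show ?thesis unfolding integer_affine_def
    by (intro exI[of _ "- a"] exI[of _ "1 - b"]) (simp add: sum_negf)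
qed

lemma mcnaughton_function_range: "mcnaughton_function f \<Longrightarrow> x \<in> unit_cube \<Longrightarrow> 0 \<le> f x \<and> f x \<le> 1"
  unfolding mcnaughton_function_def by (auto simp: PiE_iff)

lemma mcnaughton_function_plus:
  assumes f: "mcnaughton_function f" and g: "mcnaughton_function g"
  shows "mcnaughton_function (\<lambda>x\<in>unit_cube. min 1 (f x + g x))"
proof -
  obtain P Q where P: "finite P" "\<forall>p\<in>P. integer_affine p" "\<forall>x\<in>unit_cube. \<exists>p\<in>P. f x = p x"
    and Q: "finite Q" "\<forall>p\<in>Q. integer_affine p" "\<forall>x\<in>unit_cube. \<exists>p\<in>Q. g x = p x"
    using f g unfolding mcnaughton_function_def by blast
  let ?R = "insert (\<lambda>_. of_int 1) ((\<lambda>(p, q). \<lambda>x. p x + q x) ` (P \<times> Q))"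
  have "finite ?R" using P(1) Q(1) by simp
  moreover have "\<forall>p\<in>?R. integer_affine p"
    using P(2) Q(2) integer_affine_const[of 1] by (auto intro: integer_affine_add)
  moreover have "\<exists>p\<in>?R. min 1 (f x + g x) = p x" if x: "x \<in> unit_cube" for x
  proof (cases "f x + g x \<le> 1")
    case True
    obtain p q where pq: "p \<in> P" "q \<in> Q" "f x = p x" "g x = q x" using P(3) Q(3) x by blast
    have "(\<lambda>x. p x + q x) \<in> ?R" using pq(1,2) by (intro insertI2 image_eqI[of _ _ "(p, q)"]) auto
    moreover have "min 1 (f x + g x) = (\<lambda>x. p x + q x) x" using True pq(3,4) by simp
    ultimately show ?thesis by (rule rev_bexI[where x = "\<lambda>x. p x + q x"])
  next
    case False
    then show ?thesis by (intro bexI[OF _ insertI1]) simp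
  qed
  moreover have "continuous_on unit_cube (\<lambda>x\<in>unit_cube. min 1 (f x + g x))"
    using f g unfolding mcnaughton_function_def
    by (subst continuous_on_cong[OF refl, where g = "\<lambda>x. min 1 (f x + g x)"])
      (auto intro!: continuous_intros)
  moreover have "(\<lambda>x\<in>unit_cube. min 1 (f x + g x)) \<in> unit_cube \<rightarrow>\<^sub>E {0..1}"
    by (simp add: PiE_iff mcnaughton_function_range[OF f] mcnaughton_function_range[OF g])
  ultimately show ?thesis
    unfolding mcnaughton_function_def by (intro conjI exI[of _ ?R] ballI) (simp_all only: restrict_apply if_True)
qed

lemma mcnaughton_function_neg:
  assumes f: "mcnaughton_function f"
  shows "mcnaughton_function (\<lambda>x\<in>unit_cube. 1 - f x)"
proof -
  obtain P where P: "finite P" "\<forall>p\<in>P. integer_affine p" "\<forall>x\<in>unit_cube. \<exists>p\<in>P. f x = p x"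
    using f unfolding mcnaughton_function_def by blast
  let ?R = "(\<lambda>p x. 1 - p x) ` P"
  have "\<forall>p\<in>?R. integer_affine p" using P(2) integer_affine_neg by blast
  moreover have "continuous_on unit_cube (\<lambda>x\<in>unit_cube. 1 - f x)"
    using f unfolding mcnaughton_function_def
    by (subst continuous_on_cong[OF refl, where g = "\<lambda>x. 1 - f x"])
      (auto intro!: continuous_intros)
  moreover have "(\<lambda>x\<in>unit_cube. 1 - f x) \<in> unit_cube \<rightarrow>\<^sub>E {0..1}"
    by (simp add: PiE_iff mcnaughton_function_range[OF f])
  ultimately show ?thesis
    unfolding mcnaughton_function_def using P(1,3)
    by (intro conjI exI[of _ ?R]) auto
qed

lemma mcnaughton_function_zero: "mcnaughton_function (\<lambda>x\<in>unit_cube. 0)"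
proof -
  have "continuous_on unit_cube (\<lambda>x\<in>unit_cube. 0 :: real)"
    by (subst continuous_on_cong[OF refl, where g = "\<lambda>x. 0"]) auto
  then show ?thesis
    unfolding mcnaughton_function_def using integer_affine_const[of 0]
    by (intro conjI exI[of _ "{\<lambda>_. of_int 0}"]) auto
qed

lemma mv_algebra_mcnaughton_algebra: "mv_algebra (mcnaughton_algebra :: (real ^ 'n \<Rightarrow> real) mv_struct)"
proof -
  let ?M = "mcnaughton_algebra :: (real ^ 'n \<Rightarrow> real) mv_struct"
  have plus: "f \<oplus>\<^bsub>?M\<^esub> g \<in> carrier ?M" if "f \<in> carrier ?M" "g \<in> carrier ?M" for f g
    using that mcnaughton_function_plus by (simp add: mcnaughton_algebra_def)
  have neg: "\<sim>\<^bsub>?M\<^esub> f \<in> carrier ?M" if "f \<in> carrier ?M" for f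
    using that mcnaughton_function_neg by (simp add: mcnaughton_algebra_def)
  have zero: "\<zero>\<^bsub>?M\<^esub> \<in> carrier ?M"
    using mcnaughton_function_zero by (simp add: mcnaughton_algebra_def)
  have val: "(f \<oplus>\<^bsub>?M\<^esub> g) x = min 1 (f x + g x)" "(\<sim>\<^bsub>?M\<^esub> f) x = 1 - f x" "\<zero>\<^bsub>?M\<^esub> x = 0"
    if "x \<in> unit_cube" for f g x
    using that by (simp_all add: mcnaughton_algebra_def)
  have eqI: "f = g" if "f \<in> carrier ?M" "g \<in> carrier ?M" "\<And>x. x \<in> unit_cube \<Longrightarrow> f x = g x" for f g
    using that unfolding mcnaughton_algebra_def mcnaughton_function_def
    by (auto intro: PiE_ext)
  have rng: "0 \<le> f x" "f x \<le> 1" if "f \<in> carrier ?M" "x \<in> unit_cube" for f x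
    using that mcnaughton_function_range[of f x] by (simp_all add: mcnaughton_algebra_def)
  show ?thesis
  proof
    fix f g h assume f: "f \<in> carrier ?M" and g: "g \<in> carrier ?M" and h: "h \<in> carrier ?M"
    show "f \<oplus>\<^bsub>?M\<^esub> g \<oplus>\<^bsub>?M\<^esub> h = f \<oplus>\<^bsub>?M\<^esub> (g \<oplus>\<^bsub>?M\<^esub> h)"
    proof (rule eqI)
      fix x :: "real ^ 'n" assume x: "x \<in> unit_cube"
      show "(f \<oplus>\<^bsub>?M\<^esub> g \<oplus>\<^bsub>?M\<^esub> h) x = (f \<oplus>\<^bsub>?M\<^esub> (g \<oplus>\<^bsub>?M\<^esub> h)) x"
        using rng(1)[OF f x] rng(1)[OF g x] rng(1)[OF h x] by (simp add: val[OF x] min_def)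
    qed (intro plus neg zero f g h)+
  next
    fix f g assume f: "f \<in> carrier ?M" and g: "g \<in> carrier ?M"
    show "f \<oplus>\<^bsub>?M\<^esub> g \<in> carrier ?M" "\<sim>\<^bsub>?M\<^esub> f \<in> carrier ?M" by (intro plus neg f g)+
    show "f \<oplus>\<^bsub>?M\<^esub> g = g \<oplus>\<^bsub>?M\<^esub> f"
      by (rule eqI) (intro plus neg zero f g | simp add: val add.commute)+
    show "\<sim>\<^bsub>?M\<^esub> (\<sim>\<^bsub>?M\<^esub> f \<oplus>\<^bsub>?M\<^esub> g) \<oplus>\<^bsub>?M\<^esub> g = \<sim>\<^bsub>?M\<^esub> (\<sim>\<^bsub>?M\<^esub> g \<oplus>\<^bsub>?M\<^esub> f) \<oplus>\<^bsub>?M\<^esub> f"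
    proof (rule eqI)
      fix x :: "real ^ 'n" assume x: "x \<in> unit_cube"
      show "(\<sim>\<^bsub>?M\<^esub> (\<sim>\<^bsub>?M\<^esub> f \<oplus>\<^bsub>?M\<^esub> g) \<oplus>\<^bsub>?M\<^esub> g) x = (\<sim>\<^bsub>?M\<^esub> (\<sim>\<^bsub>?M\<^esub> g \<oplus>\<^bsub>?M\<^esub> f) \<oplus>\<^bsub>?M\<^esub> f) x"
        using rng[OF f x] rng[OF g x] by (simp add: val[OF x] min_def)
    qed (intro plus neg zero f g)+
  next
    fix f assume f: "f \<in> carrier ?M"
    show "f \<oplus>\<^bsub>?M\<^esub> \<zero>\<^bsub>?M\<^esub> = f"
      by (rule eqI) (intro plus neg zero f | simp add: rng[OF f] val min_absorb1 min_absorb2)+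
    show "\<sim>\<^bsub>?M\<^esub> (\<sim>\<^bsub>?M\<^esub> f) = f"
      by (rule eqI) (intro plus neg zero f | simp add: val)+
    show "f \<oplus>\<^bsub>?M\<^esub> \<sim>\<^bsub>?M\<^esub> \<zero>\<^bsub>?M\<^esub> = \<sim>\<^bsub>?M\<^esub> \<zero>\<^bsub>?M\<^esub>"
      by (rule eqI) (intro plus neg zero f | simp add: rng[OF f] val min_absorb1 min_absorb2)+
  qed (rule zero)
qed

end

theory Submission
  imports Defs
begin

text \<open>The generators \<open>e\<close> of a separating subalgebra form an injective map \<open>F\<close> from the cube to itself.
  Its pieces have integer coefficients, so \<open>F\<close> maps each finite set of cube points with denominator
  \<open>k\<close> into, and hence onto, itself. By density and compactness \<open>F\<close> is onto, and since its inverse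
  also preserves denominators, the inverses of the nondegenerate affine pieces again have integer
  coefficients. Thus the coordinates of the inverse are McNaughton functions. Substituting the
  generators into a McNaughton function stays inside the subalgebra (McNaughton's theorem, via the
  max-min representation and induction on the coefficients of clipped affine functions), so the
  subalgebra contains the coordinate projections, and by the same substitution everything.

  If an epi-subalgebra did not separate \<open>x\<close> from \<open>y\<close>, evaluation at \<open>x\<close> and at \<open>y\<close> would be two
  different homomorphisms that agree on it.\<close>

section \<open>McNaughton functions of elements of a subalgebra\<close>

lemma closed_Collect_eq_on:
  fixes f g :: "'a :: topological_space \<Rightarrow> 'b :: real_normed_vector"
  assumes "continuous_on S f" "continuous_on S g" "closed S"
  shows "closed {x \<in> S. f x = g x}"
proof -
  have "{x \<in> S. f x = g x} = S \<inter> (\<lambda>x. f x - g x) -` {0}" by auto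
  then show ?thesis
    by (simp add: continuous_closed_preimage continuous_on_diff assms)
qed

text \<open>Otherwise every piece misses one of the two bounds by more than some fixed
  \<open>d > 0\<close>. The piece that crosses the tilted chord \<open>h\<close> upwards lies below
  \<open>h\<close> at 0 and above \<open>h\<close> at 1, so it misses neither bound by more than
  \<open>d\<close>.\<close>

lemma affine_piece_between:
  fixes f :: "real \<Rightarrow> real"
  assumes Q: "finite Q" and cont: "continuous_on {0..1} f"
    and cover: "\<And>t. t \<in> {0..1} \<Longrightarrow> \<exists>q\<in>Q. f t = q t"
    and affine: "\<And>q t. q \<in> Q \<Longrightarrow> q t = q 0 + t * (q 1 - q 0)"
  shows "\<exists>q\<in>Q. q 0 \<le> f 0 \<and> f 1 \<le> q 1"
proof (rule ccontr)
  assume "\<not> ?thesis"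
  then have neg: "\<And>q. q \<in> Q \<Longrightarrow> max (q 0 - f 0) (f 1 - q 1) > 0"
    by (auto simp: not_le less_max_iff_disj)
  \<comment> \<open>Since \<open>Q\<close> is finite, one positive \<open>d\<close> lies strictly
    below all these positive maxima.\<close>
  have "\<forall>q\<in>Q. \<forall>\<^sub>F d in at_right 0. max (q 0 - f 0) (f 1 - q 1) > d"
    using order_tendstoD(2)[OF tendsto_ident_at neg] by blast
  then have "\<forall>\<^sub>F d in at_right 0. \<forall>q\<in>Q. max (q 0 - f 0) (f 1 - q 1) > d"
    using Q by (simp add: eventually_ball_finite)
  then have "\<forall>\<^sub>F d in at_right 0. d > 0 \<and> (\<forall>q\<in>Q. max (q 0 - f 0) (f 1 - q 1) > d)"
    using eventually_at_right_less[of "0::real"] by eventually_elim auto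
  then obtain d where d: "d > 0" "\<And>q. q \<in> Q \<Longrightarrow> max (q 0 - f 0) (f 1 - q 1) > d"
    using eventually_happens'[OF trivial_limit_at_right_real] by blast
  define h where "h t = (f 0 + d) + t * ((f 1 - d) - (f 0 + d))" for t
  have h_cont: "continuous_on {0..1} h" unfolding h_def by (intro continuous_intros)
  \<comment> \<open>The piece that \<open>f\<close> follows just after its last contact with the tilted chord \<open>h\<close> crosses \<open>h\<close> upwards.\<close>
  let ?S = "{t \<in> {0..1}. f t \<le> h t}"
  have "closed ?S"
    using continuous_on_closed_Collect_le[OF cont h_cont] by simp
  then have "compact ?S" by (metis (no_types, lifting) bounded_closed_interval bounded_subset
        compact_eq_bounded_closed mem_Collect_eq subsetI)
  moreover have "0 \<in> ?S" using d by (simp add: h_def)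
  ultimately obtain t where t: "t \<in> ?S" "\<And>s. s \<in> ?S \<Longrightarrow> s \<le> t"
    using compact_attains_sup[of ?S] by blast
  have "h 1 < f 1" using d by (simp add: h_def)
  then have t1: "0 \<le> t" "t < 1" using t(1) by (auto simp: less_le)
  have above: "h s < f s" if "t < s" "s \<le> 1" for s
    using t(2)[of s] that t1 by force
  let ?E = "\<lambda>q. {s \<in> {0..1}. f s = q s}"
  have q_cont: "continuous_on X q" if "q \<in> Q" for q X
  proof -
    have "continuous_on X (\<lambda>t. q 0 + t * (q 1 - q 0))" by (intro continuous_intros)
    then show ?thesis using affine[OF that] by (metis (no_types, lifting) continuous_on_cong)
  qed
  \<comment> \<open>Finitely many pieces cover the points to the right of \<open>t\<close>, so the
    contact set of a single piece \<open>q\<close> accumulates at \<open>t\<close>. By continuity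
    \<open>q\<close> also agrees with \<open>f\<close> at \<open>t\<close> itself.\<close>
  have "{t<..1} \<subseteq> (\<Union>q\<in>Q. {t<..1} \<inter> ?E q)" using cover t1 by force
  also have "\<dots> \<subseteq> (\<Union>q\<in>Q. closure ({t<..1} \<inter> ?E q))"
    by (intro UN_mono closure_subset order_refl)
  finally have "closure {t<..1} \<subseteq> (\<Union>q\<in>Q. closure ({t<..1} \<inter> ?E q))"
    using Q by (intro closure_minimal) auto
  moreover have "t \<in> closure {t<..1}" using t1 by simp
  ultimately obtain q where q: "q \<in> Q" "t \<in> closure ({t<..1} \<inter> ?E q)" by blast
  have "closed (?E q)"
    by (intro closed_Collect_eq_on cont q_cont q(1)) simp
  then have "t \<in> ?E q"
    using q(2) closure_minimal[of "{t<..1} \<inter> ?E q" "?E q"] by blast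
  moreover obtain s where s: "s \<in> {t<..1} \<inter> ?E q" using q(2) closure_empty by (metis all_not_in_conv)
  ultimately have le: "q t \<le> h t" and gt: "h s < q s" and "t < s" "s \<le> 1"
    using t(1) above[of s] by auto
  \<comment> \<open>The difference \<open>q - h\<close> is affine, nonpositive at \<open>t\<close>
    and positive at the later point \<open>s\<close>. Its slope is therefore positive, which fixes
    its signs at 0 and 1.\<close>
  define a b where "a = q 0 - (f 0 + d)" and "b = (q 1 - q 0) - ((f 1 - d) - (f 0 + d))"
  have qh: "q r - h r = a + r * b" for r
    using affine[OF q(1), of r] by (simp add: a_def b_def h_def algebra_simps)
  have ab: "a + t * b \<le> 0" "0 < a + s * b" using qh[of t] qh[of s] le gt by linarith+
  then have "0 < (s - t) * b" by (simp add: algebra_simps)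
  then have b: "0 < b" using \<open>t < s\<close> by (simp add: zero_less_mult_iff)
  have "a \<le> 0" using ab(1) mult_nonneg_nonneg[OF t1(1) less_imp_le[OF b]] by linarith
  moreover have "0 < a + b" using ab(2) mult_right_mono[OF \<open>s \<le> 1\<close> less_imp_le[OF b]] by linarith
  ultimately show False using d(2)[OF q(1)] by (simp add: a_def b_def)
qed

lemma integer_affine_continuous:
  assumes "integer_affine p"
  shows "continuous_on X p"
proof -
  obtain a b where p: "p = (\<lambda>x. (\<Sum>i\<in>UNIV. of_int (a $ i) * x $ i) + of_int b)"
    using assms unfolding integer_affine_def by blast
  show ?thesis unfolding p by (intro continuous_intros)
qed

text \<open>For each \<open>y\<close> take the minimum of the pieces lying above \<open>f\<close> at
  \<open>y\<close>. At \<open>y\<close> it is at least \<open>f y\<close>; at any other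
  \<open>x\<close> it is at most \<open>f x\<close>, by \<open>affine_piece_between\<close> on the
  segment from \<open>x\<close> to \<open>y\<close>. The maximum over all \<open>y\<close> is thus
  \<open>f\<close>, and it is finite because each index set is a subset of \<open>P\<close>.\<close>

lemma mcnaughton_max_min:
  fixes f :: "real ^ 'n \<Rightarrow> real"
  assumes f: "mcnaughton_function f"
  obtains JJ where "finite JJ" "JJ \<noteq> {}"
    and "\<And>J. J \<in> JJ \<Longrightarrow> finite J \<and> J \<noteq> {} \<and> (\<forall>p\<in>J. integer_affine p)"
    and "\<And>x. x \<in> unit_cube \<Longrightarrow> f x = Max ((\<lambda>J. Min ((\<lambda>p. p x) ` J)) ` JJ)"
proof -
  obtain P where P: "finite P" "\<And>p. p \<in> P \<Longrightarrow> integer_affine p"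
    and cover: "\<And>x. x \<in> unit_cube \<Longrightarrow> \<exists>p\<in>P. f x = p x" and cont: "continuous_on unit_cube f"
    using f unfolding mcnaughton_function_def by blast
  define J where "J y = {p \<in> P. f y \<le> p y}" for y
  have JP: "J y \<subseteq> P" for y by (auto simp: J_def)
  have J: "finite (J y)" for y using P(1) by (simp add: J_def)
  have J_ne: "J y \<noteq> {}" if "y \<in> unit_cube" for y using cover[OF that] by (force simp: J_def)
  have le: "\<exists>p\<in>J y. p x \<le> f x" if x: "x \<in> unit_cube" and y: "y \<in> unit_cube" for x y
  proof -
    define c where "c t = x + t *\<^sub>R (y - x)" for t :: real
    have c_in: "c t \<in> unit_cube" if "t \<in> {0..1}" for t
    proof -
      have "(1 - t) *\<^sub>R x + t *\<^sub>R y \<in> unit_cube"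
        using that x y convex_box(1) by (auto intro!: convexD)
      then show ?thesis by (simp add: c_def algebra_simps)
    qed
    have "\<exists>q\<in>(\<lambda>p. p \<circ> c) ` P. q 0 \<le> (f \<circ> c) 0 \<and> (f \<circ> c) 1 \<le> q 1"
    proof (rule affine_piece_between)
      show "finite ((\<lambda>p. p \<circ> c) ` P)" using P by simp
      have "continuous_on {0..1} c" unfolding c_def by (intro continuous_intros)
      then show "continuous_on {0..1} (f \<circ> c)"
        using cont c_in by (intro continuous_on_compose) (auto intro: continuous_on_subset)
      show "\<exists>q\<in>(\<lambda>p. p \<circ> c) ` P. (f \<circ> c) t = q t" if "t \<in> {0..1}" for t
        using cover[OF c_in[OF that]] by auto
      fix q t assume "q \<in> (\<lambda>p. p \<circ> c) ` P"
      then obtain p where p: "p \<in> P" "q = p \<circ> c" by blast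
      obtain a b where "\<And>x. p x = (\<Sum>i\<in>UNIV. of_int (a $ i) * x $ i) + of_int b"
        using P(2)[OF p(1)] unfolding integer_affine_def by blast
      then show "q t = q 0 + t * (q 1 - q 0)"
        by (simp add: p c_def algebra_simps sum.distrib sum_subtractf sum_distrib_left)
    qed
    then show ?thesis by (auto simp: c_def J_def)
  qed
  show ?thesis
  proof (rule that)
    show fin: "finite (J ` unit_cube)"
      using P(1) JP by (intro finite_subset[OF _ finite_Pow_iff[THEN iffD2, OF P(1)]]) auto
    show "J ` unit_cube \<noteq> {}" by (simp add: interval_ne_empty_cart)
    show "finite K \<and> K \<noteq> {} \<and> (\<forall>p\<in>K. integer_affine p)" if "K \<in> J ` unit_cube" for K
      using that J J_ne JP P(2) by blast
    fix x :: "real ^ 'n" assume x: "x \<in> unit_cube"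
    show "f x = Max ((\<lambda>J. Min ((\<lambda>p. p x) ` J)) ` J ` unit_cube)"
    proof (rule antisym)
      have "f x \<le> Min ((\<lambda>p. p x) ` J x)"
        using J J_ne[OF x] by (subst Min_ge_iff) (auto simp: J_def)
      also have "\<dots> \<le> Max ((\<lambda>J. Min ((\<lambda>p. p x) ` J)) ` J ` unit_cube)"
        using fin x by (intro Max_ge) auto
      finally show "f x \<le> \<dots>" .
      show "Max ((\<lambda>J. Min ((\<lambda>p. p x) ` J)) ` J ` unit_cube) \<le> f x"
        using fin x le[OF x] J J_ne by (subst Max_le_iff) (auto simp: Min_le_iff)
    qed
  qed
qed

section \<open>MV-operations and clipped integer affine functions\<close>

definition clip :: "real \<Rightarrow> real" where
  "clip t = max 0 (min 1 t)"

lemma mono_clip: "mono clip"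
  by (auto simp: mono_def clip_def)

text \<open>The right side is the Lukasiewicz product of \<open>clip s\<close> plus
  \<open>y\<close>, truncated at 1, with \<open>clip (s + 1)\<close>. So adding a generator inside
  \<open>clip\<close> reduces to MV-operations on clips without it, at two consecutive
  constants.\<close>

lemma clip_add:
  assumes "0 \<le> y" "y \<le> 1"
  shows "clip (s + y) = max 0 (min 1 (clip s + y) + clip (s + 1) - 1)"
  using assms unfolding clip_def by linarith

context
  fixes A :: "(real ^ 'n \<Rightarrow> real) set"
  assumes sub: "mv_subalgebra A mcnaughton_algebra"
begin

lemma subalgebra_mcnaughton: "f \<in> A \<Longrightarrow> mcnaughton_function f"
  using sub by (auto simp: mv_subalgebra_def mcnaughton_algebra_def)

lemma subalgebra_range: "f \<in> A \<Longrightarrow> x \<in> unit_cube \<Longrightarrow> 0 \<le> f x \<and> f x \<le> 1"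
  using mcnaughton_function_range subalgebra_mcnaughton by blast

lemma subalgebra_zero: "(\<lambda>x\<in>unit_cube. 0) \<in> A"
  and subalgebra_neg: "f \<in> A \<Longrightarrow> (\<lambda>x\<in>unit_cube. 1 - f x) \<in> A"
  and subalgebra_plus: "f \<in> A \<Longrightarrow> g \<in> A \<Longrightarrow> (\<lambda>x\<in>unit_cube. min 1 (f x + g x)) \<in> A"
  using sub by (auto simp: mv_subalgebra_def mcnaughton_algebra_def)

lemma subalgebra_times:
  assumes "f \<in> A" "g \<in> A"
  shows "(\<lambda>x\<in>unit_cube. max 0 (f x + g x - 1)) \<in> A"
proof -
  \<comment> \<open>The nested restrictions are literally the operations of the algebra, so that the
    closure rules apply by rewriting.\<close>
  have "(\<lambda>x\<in>unit_cube. max 0 (f x + g x - 1)) =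
    (\<lambda>x\<in>unit_cube. 1 - (\<lambda>x\<in>unit_cube. min 1 ((\<lambda>x\<in>unit_cube. 1 - f x) x + (\<lambda>x\<in>unit_cube. 1 - g x) x)) x)"
    by (auto simp: fun_eq_iff)
  then show ?thesis by (simp only: subalgebra_neg subalgebra_plus assms)
qed

lemma subalgebra_max:
  assumes "f \<in> A" "g \<in> A"
  shows "(\<lambda>x\<in>unit_cube. max (f x) (g x)) \<in> A"
proof -
  have "(\<lambda>x\<in>unit_cube. max (f x) (g x)) =
    (\<lambda>x\<in>unit_cube. min 1 ((\<lambda>x\<in>unit_cube. max 0 (f x + (\<lambda>x\<in>unit_cube. 1 - g x) x - 1)) x + g x))"
  proof (intro restrict_ext)
    fix x :: "real ^ 'n" assume x: "x \<in> unit_cube"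
    show "max (f x) (g x) =
      min 1 ((\<lambda>x\<in>unit_cube. max 0 (f x + (\<lambda>x\<in>unit_cube. 1 - g x) x - 1)) x + g x)"
      using subalgebra_range[OF assms(1) x] subalgebra_range[OF assms(2) x] x by (simp add: max_def min_def)
  qed
  then show ?thesis by (simp only: subalgebra_neg subalgebra_plus subalgebra_times assms)
qed

lemma subalgebra_min:
  assumes "f \<in> A" "g \<in> A"
  shows "(\<lambda>x\<in>unit_cube. min (f x) (g x)) \<in> A"
proof -
  have "(\<lambda>x\<in>unit_cube. min (f x) (g x)) =
    (\<lambda>x\<in>unit_cube. 1 - (\<lambda>x\<in>unit_cube. max ((\<lambda>x\<in>unit_cube. 1 - f x) x) ((\<lambda>x\<in>unit_cube. 1 - g x) x)) x)"
    by (auto simp: fun_eq_iff)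
  then show ?thesis by (simp only: subalgebra_neg subalgebra_max assms)
qed

lemma subalgebra_Max:
  assumes "finite J" "J \<noteq> {}" "\<And>j. j \<in> J \<Longrightarrow> (\<lambda>x\<in>unit_cube. f j x) \<in> A"
  shows "(\<lambda>x\<in>unit_cube. Max ((\<lambda>j. f j x) ` J)) \<in> A"
  using assms
proof (induction rule: finite_ne_induct)
  case (insert j J)
  have "(\<lambda>x\<in>unit_cube. max ((\<lambda>x\<in>unit_cube. f j x) x) ((\<lambda>x\<in>unit_cube. Max ((\<lambda>j. f j x) ` J)) x)) \<in> A"
    using insert by (intro subalgebra_max) auto
  then show ?case using insert.hyps by (simp del: restrict_apply add: restrict_apply' cong: restrict_cong)
qed simp

lemma subalgebra_Min:
  assumes "finite J" "J \<noteq> {}" "\<And>j. j \<in> J \<Longrightarrow> (\<lambda>x\<in>unit_cube. f j x) \<in> A"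
  shows "(\<lambda>x\<in>unit_cube. Min ((\<lambda>j. f j x) ` J)) \<in> A"
  using assms
proof (induction rule: finite_ne_induct)
  case (insert j J)
  have "(\<lambda>x\<in>unit_cube. min ((\<lambda>x\<in>unit_cube. f j x) x) ((\<lambda>x\<in>unit_cube. Min ((\<lambda>j. f j x) ` J)) x)) \<in> A"
    using insert by (intro subalgebra_min) auto
  then show ?case using insert.hyps by (simp del: restrict_apply add: restrict_apply' cong: restrict_cong)
qed simp

context
  fixes e :: "'n \<Rightarrow> real ^ 'n \<Rightarrow> real"
  assumes e: "\<And>i. e i \<in> A"
begin

text \<open>The hypothesis ranges over all constants because \<open>clip_add\<close> uses both
  \<open>b\<close> and \<open>b + 1\<close>.\<close>

lemma subalgebra_clip_add:
  assumes "\<And>b :: int. (\<lambda>x\<in>unit_cube. clip (q x + of_int b)) \<in> A"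
  shows "(\<lambda>x\<in>unit_cube. clip (q x + e i x + of_int b)) \<in> A"
proof -
  have "(\<lambda>x\<in>unit_cube. clip (q x + e i x + of_int b)) =
    (\<lambda>x\<in>unit_cube. max 0 ((\<lambda>x\<in>unit_cube. min 1 ((\<lambda>x\<in>unit_cube. clip (q x + of_int b)) x + e i x)) x
      + (\<lambda>x\<in>unit_cube. clip (q x + of_int (b + 1))) x - 1))"
  proof (intro restrict_ext)
    fix x :: "real ^ 'n" assume x: "x \<in> unit_cube"
    show "clip (q x + e i x + of_int b) =
      max 0 ((\<lambda>x\<in>unit_cube. min 1 ((\<lambda>x\<in>unit_cube. clip (q x + of_int b)) x + e i x)) x
        + (\<lambda>x\<in>unit_cube. clip (q x + of_int (b + 1))) x - 1)"
      using clip_add[of "e i x" "q x + of_int b"] subalgebra_range[OF e x, of i] x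
      by (simp add: add_ac)
  qed
  also have "\<dots> \<in> A" by (intro subalgebra_times subalgebra_plus assms e)
  finally show ?thesis .
qed

text \<open>Negation reflects the truncation: \<open>1 - clip t = clip (1 - t)\<close>.\<close>

lemma subalgebra_clip_uminus:
  assumes "\<And>b :: int. (\<lambda>x\<in>unit_cube. clip (q x + of_int b)) \<in> A"
  shows "(\<lambda>x\<in>unit_cube. clip (- q x + of_int b)) \<in> A"
proof -
  have "(\<lambda>x\<in>unit_cube. clip (- q x + of_int b)) =
    (\<lambda>x\<in>unit_cube. 1 - (\<lambda>x\<in>unit_cube. clip (q x + of_int (1 - b))) x)"
    by (auto simp: fun_eq_iff clip_def)
  also have "\<dots> \<in> A" by (intro subalgebra_neg assms)
  finally show ?thesis .
qed

lemma subalgebra_clip_add_mult: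
  assumes "\<And>b :: int. (\<lambda>x\<in>unit_cube. clip (q x + of_int b)) \<in> A"
  shows "(\<lambda>x\<in>unit_cube. clip (q x + of_int m * e i x + of_int b)) \<in> A"
proof -
  have nat: "(\<lambda>x\<in>unit_cube. clip (q x + of_nat k * e i x + of_int b)) \<in> A"
    if "\<And>b :: int. (\<lambda>x\<in>unit_cube. clip (q x + of_int b)) \<in> A" for q k and b :: int
  proof (induction k arbitrary: b)
    case 0
    then show ?case using that by (simp del: restrict_apply)
  next
    case (Suc k)
    show ?case using subalgebra_clip_add[of "\<lambda>x. q x + of_nat k * e i x" i b] Suc
      by (simp del: restrict_apply add: algebra_simps)
  qed
  show ?thesis
  proof (cases m rule: int_cases2)
    case (nonneg k)
    then show ?thesis using nat[of q k b] assms by (simp del: restrict_apply)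
  next
    case (nonpos k)
    \<comment> \<open>A negative multiple is reached by negating, adding a positive multiple, and
      negating back.\<close>
    have "(\<lambda>x\<in>unit_cube. clip (- (- q x + of_nat k * e i x) + of_int b)) \<in> A"
      by (intro subalgebra_clip_uminus nat assms)
    then show ?thesis using nonpos by (simp del: restrict_apply)
  qed
qed

lemma subalgebra_clip_integer_affine:
  assumes "integer_affine p"
  shows "(\<lambda>x\<in>unit_cube. clip (p (\<chi> i. e i x))) \<in> A"
proof -
  obtain a b where p: "\<And>x. p x = (\<Sum>i\<in>UNIV. of_int (a $ i) * x $ i) + of_int b"
    using assms unfolding integer_affine_def by blast
  have "(\<lambda>x\<in>unit_cube. clip ((\<Sum>i\<in>I. of_int (a $ i) * e i x) + of_int b)) \<in> A"
    if "finite I" for I and b :: int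
    using that
  proof (induction I arbitrary: b)
    case empty
    \<comment> \<open>An integer constant clips to 0 or 1, and both constant functions lie in every
      subalgebra.\<close>
    consider "b \<le> 0" | "b \<ge> 1" by linarith
    then show ?case
    proof cases
      case 1
      then show ?thesis using subalgebra_zero by (simp del: restrict_apply add: clip_def)
    next
      case 2
      then have "(\<lambda>x\<in>unit_cube :: (real ^ 'n) set. clip (of_int b)) = (\<lambda>x\<in>unit_cube. 1 - (\<lambda>x\<in>unit_cube. 0) x)"
        by (auto simp: fun_eq_iff clip_def)
      then show ?thesis using subalgebra_neg[OF subalgebra_zero] by (simp only: sum.empty add_0_left)
    qed
  next
    case (insert i I)
    show ?case
      using subalgebra_clip_add_mult[OF insert.IH, of "a $ i" i b] insert.hyps
      by (simp del: restrict_apply add: add_ac)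
  qed
  from this[of UNIV b] show ?thesis by (simp del: restrict_apply add: p)
qed

text \<open>For the coordinate projections \<open>e\<close>, this says that they generate all McNaughton functions.\<close>

lemma subalgebra_mcnaughton_comp:
  assumes f: "mcnaughton_function f"
  shows "(\<lambda>x\<in>unit_cube. f (\<chi> i. e i x)) \<in> A"
proof -
  obtain JJ where JJ: "finite JJ" "JJ \<noteq> {}"
    and J: "\<And>J. J \<in> JJ \<Longrightarrow> finite J \<and> J \<noteq> {} \<and> (\<forall>p\<in>J. integer_affine p)"
    and eq: "\<And>x. x \<in> unit_cube \<Longrightarrow> f x = Max ((\<lambda>J. Min ((\<lambda>p. p x) ` J)) ` JJ)"
    using mcnaughton_max_min[OF f] by metis
  \<comment> \<open>Clipping fixes the values of \<open>f\<close> and, being monotone, commutes with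
    finite maxima and minima. Hence each affine piece may be replaced by its clip.\<close>
  have "f (\<chi> i. e i x) = Max ((\<lambda>J. Min ((\<lambda>p. clip (p (\<chi> i. e i x))) ` J)) ` JJ)"
    if x: "x \<in> unit_cube" for x
  proof -
    let ?y = "\<chi> i. e i x"
    have y: "?y \<in> unit_cube" using subalgebra_range[OF e x] by (simp add: mem_box_cart)
    have "f ?y = clip (f ?y)"
      using mcnaughton_function_range[OF f y] by (simp add: clip_def)
    also have "\<dots> = Max (clip ` (\<lambda>J. Min ((\<lambda>p. p ?y) ` J)) ` JJ)"
      using JJ by (simp add: eq[OF y] mono_Max_commute[OF mono_clip])
    also have "clip ` (\<lambda>J. Min ((\<lambda>p. p ?y) ` J)) ` JJ = (\<lambda>J. Min ((\<lambda>p. clip (p ?y)) ` J)) ` JJ"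
      unfolding image_image
      by (intro image_cong refl) (simp add: J mono_Min_commute[OF mono_clip] image_image)
    finally show ?thesis .
  qed
  then have "(\<lambda>x\<in>unit_cube. f (\<chi> i. e i x)) =
      (\<lambda>x\<in>unit_cube. Max ((\<lambda>J. Min ((\<lambda>p. clip (p (\<chi> i. e i x))) ` J)) ` JJ))"
    by (simp del: restrict_apply cong: restrict_cong)
  also have "\<dots> \<in> A"
    using J by (intro subalgebra_Max JJ subalgebra_Min subalgebra_clip_integer_affine) auto
  finally show ?thesis .
qed

end

end

section \<open>Injective McNaughton maps of the cube\<close>

lemma integer_affine_Ints:
  assumes "integer_affine p" "\<And>i. of_nat k * x $ i \<in> \<int>"
  shows "of_nat k * p x \<in> \<int>"
proof -
  obtain a b where p: "\<And>x. p x = (\<Sum>i\<in>UNIV. of_int (a $ i) * x $ i) + of_int b"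
    using assms(1) unfolding integer_affine_def by blast
  have "of_nat k * p x = (\<Sum>i\<in>UNIV. of_int (a $ i) * (of_nat k * x $ i)) + of_nat k * of_int b"
    by (simp add: p distrib_left sum_distrib_left mult.left_commute)
  also have "\<dots> \<in> \<int>" by (intro Ints_add Ints_sum Ints_mult assms(2)) simp_all
  finally show ?thesis .
qed

text \<open>The denominator is \<open>Suc k\<close> because denominator 0 would admit every point of
  the cube.\<close>

definition grid :: "nat \<Rightarrow> (real ^ 'n) set" where
  "grid k = {x \<in> unit_cube. \<forall>i. of_nat (Suc k) * x $ i \<in> \<int>}"

lemma finite_grid: "finite (grid k :: (real ^ 'n) set)"
proof -
  let ?S = "(\<lambda>m. of_int m / of_nat (Suc k)) ` {0..int (Suc k)} :: real set"
  have "x \<in> (\<lambda>v. \<chi> i. v i) ` (UNIV \<rightarrow>\<^sub>E ?S)" if x: "x \<in> grid k" for x :: "real ^ 'n"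
  proof (rule image_eqI)
    show "x = (\<chi> i. x $ i)" by simp
    show "($) x \<in> UNIV \<rightarrow>\<^sub>E ?S"
    proof (simp only: PiE_UNIV_domain, intro Pi_I)
      fix i
      obtain m where m: "of_nat (Suc k) * x $ i = of_int m" using x by (auto simp: grid_def Ints_def)
      have "0 \<le> x $ i" "x $ i \<le> 1" using x by (auto simp: grid_def mem_box_cart)
      then have "0 \<le> real (Suc k) * x $ i" "real (Suc k) * x $ i \<le> real (Suc k) * 1"
        by (auto intro: mult_left_mono)
      then have "m \<in> {0..int (Suc k)}" unfolding m by auto
      moreover have "x $ i = of_int m / of_nat (Suc k)" by (simp add: m[symmetric] del: of_nat_Suc)
      ultimately show "x $ i \<in> ?S" by blast
    qed
  qed
  then have "grid k \<subseteq> (\<lambda>v. (\<chi> i. v i) :: real ^ 'n) ` (UNIV \<rightarrow>\<^sub>E ?S)" by blast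
  then show ?thesis by (rule finite_subset) (intro finite_imageI finite_PiE; simp)
qed

definition grid_floor :: "nat \<Rightarrow> real ^ 'n \<Rightarrow> real ^ 'n" where
  "grid_floor k x = (\<chi> i. of_int \<lfloor>of_nat (Suc k) * x $ i\<rfloor> / of_nat (Suc k))"

lemma grid_floor_Ints: "of_nat (Suc k) * grid_floor k x $ i \<in> \<int>"
  by (simp add: grid_floor_def del: of_nat_Suc)

lemma grid_floor_in_grid: "x \<in> unit_cube \<Longrightarrow> grid_floor k x \<in> grid k"
  unfolding grid_def
proof (intro CollectI conjI allI grid_floor_Ints)
  assume x: "x \<in> unit_cube"
  have "0 \<le> grid_floor k x $ i \<and> grid_floor k x $ i \<le> 1" for i
  proof -
    have xi: "0 \<le> x $ i" "x $ i \<le> 1" using x by (auto simp: mem_box_cart)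
    have "of_int \<lfloor>real (Suc k) * x $ i\<rfloor> \<le> real (Suc k) * x $ i" by simp
    also have "\<dots> \<le> real (Suc k) * 1" using xi by (intro mult_left_mono) auto
    finally have "of_int \<lfloor>real (Suc k) * x $ i\<rfloor> \<le> real (Suc k)" by simp
    then show ?thesis using xi by (simp add: grid_floor_def del: of_nat_Suc)
  qed
  then show "grid_floor k x \<in> unit_cube" by (simp add: mem_box_cart)
qed

lemma grid_floor_tendsto: "(\<lambda>k. grid_floor k x) \<longlonglongrightarrow> x"
proof (rule vec_tendstoI)
  fix i
  show "(\<lambda>k. grid_floor k x $ i) \<longlonglongrightarrow> x $ i"
  proof (rule real_tendsto_sandwich)
    show "(\<lambda>k. x $ i - 1 / of_nat (Suc k)) \<longlonglongrightarrow> x $ i"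
      using tendsto_diff[OF tendsto_const LIMSEQ_Suc[OF lim_1_over_n]] by simp
    show "\<forall>\<^sub>F k in sequentially. grid_floor k x $ i \<le> x $ i"
      by (simp add: grid_floor_def divide_le_eq mult.commute del: of_nat_Suc)
    have "x $ i - 1 / real (Suc k) \<le> grid_floor k x $ i" for k
    proof -
      have "(real (Suc k) * x $ i - 1) / real (Suc k) \<le> of_int \<lfloor>real (Suc k) * x $ i\<rfloor> / real (Suc k)"
        by (intro divide_right_mono) linarith+
      then show ?thesis by (simp add: grid_floor_def diff_divide_distrib del: of_nat_Suc)
    qed
    then show "\<forall>\<^sub>F k in sequentially. x $ i - 1 / real (Suc k) \<le> grid_floor k x $ i" by simp
  qed simp
qed

text \<open>A point of \<open>W\<close> outside that closure lies in the frontier of some member.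
  Frontiers of closed sets are closed with empty interior, and so is a finite union of them, so
  these points form an empty open set. This discards affine pieces that are followed only on thin
  sets.\<close>

lemma open_subset_closure_Union_interior:
  assumes "finite K" "\<And>S. S \<in> K \<Longrightarrow> closed S" "open W" "W \<subseteq> \<Union>K"
  shows "W \<subseteq> closure (\<Union> (interior ` K))"
proof -
  have "interior (frontier S) = {}" if "closed S" for S :: "'a set"
  proof -
    have "interior (frontier S) \<subseteq> interior S"
      using that by (intro interior_mono frontier_subset_closed)
    moreover have "interior (frontier S) \<subseteq> frontier S" by (rule interior_subset)
    ultimately show ?thesis by (auto simp: frontier_def)
  qed
  moreover have "interior (\<Union>L) = {}"
    if "finite L" "\<And>S. S \<in> L \<Longrightarrow> closed S \<and> interior S = {}" for L :: "'a set set"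
    using that by (induction L) (auto simp: interior_closed_Un_empty_interior closed_Union)
  ultimately have "interior (\<Union> (frontier ` K)) = {}"
    using assms(1,2) by (metis (no_types, lifting) finite_imageI frontier_closed imageE)
  moreover have "W - closure (\<Union> (interior ` K)) \<subseteq> interior (\<Union> (frontier ` K))"
  proof (rule interior_maximal)
    show "W - closure (\<Union> (interior ` K)) \<subseteq> \<Union> (frontier ` K)"
      using assms(2,4) closure_subset[of "\<Union> (interior ` K)"] by (fastforce simp: frontier_def)
  qed (use assms(3) in auto)
  ultimately show ?thesis by blast
qed

lemma interior_unit_cube_dense: "unit_cube \<subseteq> closure (interior (unit_cube :: (real ^ 'n) set))"
proof -
  have "box 0 (1 :: real ^ 'n) \<noteq> {}" by (simp add: interval_ne_empty_cart)
  then show ?thesis by (simp add: interior_cbox closure_box)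
qed

lemma integer_affine_mapE:
  fixes p :: "real ^ 'n \<Rightarrow> real ^ 'n"
  assumes "\<And>i. integer_affine (\<lambda>x. p x $ i)"
  obtains M b where "\<And>x. p x = M *v x + b" "\<And>i. b $ i \<in> \<int>"
proof -
  obtain a b where ab: "\<And>i x. p x $ i = (\<Sum>j\<in>UNIV. of_int (a i $ j) * x $ j) + of_int (b i)"
    using assms unfolding integer_affine_def by metis
  show ?thesis
    by (rule that[of "\<chi> i j. of_int (a i $ j)" "\<chi> i. of_int (b i)"])
      (simp_all add: vec_eq_iff ab matrix_vector_mult_def)
qed

lemma integer_affine_matrix_component:
  fixes M :: "real ^ 'n ^ 'n"
  assumes "\<And>i j. M $ i $ j \<in> \<int>" "\<And>i. b $ i \<in> \<int>"
  shows "integer_affine (\<lambda>x. (M *v x + b) $ i)"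
proof -
  have M: "of_int \<lfloor>M $ i $ j\<rfloor> = M $ i $ j" for j using assms(1)[of i j] by (auto elim: Ints_cases)
  have b: "of_int \<lfloor>b $ i\<rfloor> = b $ i" using assms(2)[of i] by (auto elim: Ints_cases)
  show ?thesis unfolding integer_affine_def
    by (intro exI[of _ "\<chi> j. \<lfloor>M $ i $ j\<rfloor>"] exI[of _ "\<lfloor>b $ i\<rfloor>"])
      (simp add: matrix_vector_mult_def M b)
qed

section \<open>Inverting an injective McNaughton map\<close>

context
  fixes F :: "real ^ 'n \<Rightarrow> real ^ 'n" and P :: "(real ^ 'n \<Rightarrow> real ^ 'n) set"
  assumes F_cube: "F ` unit_cube \<subseteq> unit_cube" and F_inj: "inj_on F unit_cube"
    and F_cont: "continuous_on unit_cube F" and P_fin: "finite P"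
    and P_int: "\<And>p i. p \<in> P \<Longrightarrow> integer_affine (\<lambda>x. p x $ i)"
    and P_cover: "\<And>x. x \<in> unit_cube \<Longrightarrow> \<exists>p\<in>P. F x = p x"
begin

text \<open>Integer coefficients do not enlarge denominators, so \<open>F\<close> maps the grid into
  itself; an injective self-map of a finite set is onto.\<close>

lemma image_grid: "F ` grid k = grid k"
proof (rule endo_inj_surj[OF finite_grid])
  show "F ` grid k \<subseteq> grid k"
  proof (intro image_subsetI)
    fix x :: "real ^ 'n" assume x: "x \<in> grid k"
    then obtain p where p: "p \<in> P" "F x = p x" using P_cover by (auto simp: grid_def)
    have "of_nat (Suc k) * F x $ i \<in> \<int>" for i
      unfolding p(2) by (rule integer_affine_Ints[OF P_int[OF p(1)]]) (use x in \<open>auto simp: grid_def\<close>)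
    then show "F x \<in> grid k" using x F_cube by (auto simp: grid_def)
  qed
  show "inj_on F (grid k)" using F_inj by (rule inj_on_subset) (auto simp: grid_def)
qed

text \<open>The image is compact and contains every grid, and the grids are dense in the
  cube.\<close>

lemma image_unit_cube: "F ` unit_cube = unit_cube"
proof (intro subset_antisym F_cube subsetI)
  fix x :: "real ^ 'n" assume x: "x \<in> unit_cube"
  have "grid_floor k x \<in> F ` unit_cube" for k
    using grid_floor_in_grid[OF x, of k] image_grid[of k] by (force simp: grid_def)
  moreover have "closed (F ` unit_cube)"
    by (intro compact_imp_closed compact_continuous_image F_cont) simp
  ultimately show "x \<in> F ` unit_cube"
    using closed_sequentially[OF _ _ grid_floor_tendsto[of x]] by simp
qed

text \<open>Injectivity of \<open>F\<close> near \<open>x0\<close> makes the linear part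
  \<open>M\<close> invertible. Its inverse \<open>B\<close> is integral because the local inverse of
  \<open>F\<close> sends grid points to points of the same grid.\<close>

lemma integer_affine_local_inverse:
  assumes p: "p \<in> P" and x0: "x0 \<in> interior {x \<in> unit_cube. F x = p x}"
  shows "\<exists>q. (\<forall>i. integer_affine (\<lambda>y. q y $ i)) \<and> (\<forall>x. q (p x) = x)"
proof -
  let ?U = "interior {x \<in> unit_cube. F x = p x}"
  have U: "x \<in> unit_cube" "F x = p x" if "x \<in> ?U" for x using that interior_subset by blast+
  obtain M b where pM: "\<And>x. p x = M *v x + b" and b: "\<And>i. b $ i \<in> \<int>"
    using integer_affine_mapE[of p] P_int[OF p] by metis
  \<comment> \<open>A small move from \<open>x0\<close> along a kernel vector stays in
    \<open>?U\<close> without changing \<open>F\<close>, so injectivity forces the vector to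
    vanish.\<close>
  have "\<forall>v. M *v v = 0 \<longrightarrow> v = 0"
  proof (intro allI impI)
    fix v assume v: "M *v v = 0"
    have "((\<lambda>t. x0 + t *\<^sub>R v) \<longlongrightarrow> x0 + 0 *\<^sub>R v) (at_right 0)" by (intro tendsto_intros)
    then have "\<forall>\<^sub>F t in at_right 0. x0 + t *\<^sub>R v \<in> ?U"
      using x0 by (intro topological_tendstoD) auto
    then have "\<forall>\<^sub>F t in at_right (0::real). 0 < t \<and> x0 + t *\<^sub>R v \<in> ?U"
      using eventually_at_right_less[of "0::real"] by eventually_elim simp
    then obtain t :: real where t: "0 < t" "x0 + t *\<^sub>R v \<in> ?U"
      using eventually_happens'[OF trivial_limit_at_right_real] by blast
    have "F (x0 + t *\<^sub>R v) = F x0"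
      by (simp add: U(2)[OF t(2)] U(2)[OF x0] pM matrix_vector_right_distrib matrix_vector_mult_scaleR v)
    then have "x0 + t *\<^sub>R v = x0" using inj_onD[OF F_inj _ U(1)[OF t(2)] U(1)[OF x0]] by blast
    then show "v = 0" using t(1) by simp
  qed
  then obtain B where BM: "B ** M = mat 1" using matrix_left_invertible_ker by blast
  then have MB: "M ** B = mat 1" by (simp add: matrix_left_right_inverse)
  have pB: "p (B *v (y - b)) = y" for y by (simp add: pM matrix_vector_mul_assoc MB)
  have Bp: "B *v (p x - b) = x" for x by (simp add: pM matrix_vector_mul_assoc BM)
  \<comment> \<open>The grid point \<open>y\<close> has a preimage under \<open>F\<close> in the
    grid by \<open>image_grid\<close>, and injectivity identifies it with
    \<open>B *v (y - b)\<close>. That \<open>y\<close> lies in the cube follows from its being a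
    value of \<open>F\<close>.\<close>
  have grid: "B *v (y - b) \<in> grid k"
    if "B *v (y - b) \<in> ?U" "\<And>i. of_nat (Suc k) * y $ i \<in> \<int>" for y k
  proof -
    have y: "F (B *v (y - b)) = y" using U(2)[OF that(1)] pB by simp
    then have "y \<in> unit_cube" using imageI[OF U(1)[OF that(1)]] F_cube by (metis subsetD)
    then have "y \<in> grid k" using that(2) by (simp add: grid_def)
    then obtain x where x: "x \<in> grid k" "F x = y" using image_grid by (metis imageE)
    then have "x \<in> unit_cube" by (simp add: grid_def)
    then have "x = B *v (y - b)"
      using inj_onD[OF F_inj _ _ U(1)[OF that(1)]] y x(2) by metis
    then show ?thesis using x(1) by simp
  qed
  have B_int: "B $ i $ j \<in> \<int>" for i j
  proof -
    \<comment> \<open>Two neighbouring points of denominator \<open>Suc k\<close> near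
      \<open>p x0\<close>, one step apart in direction \<open>j\<close>. Their images under the
      local inverse differ by column \<open>j\<close> of \<open>B\<close> divided by
      \<open>Suc k\<close>, and both images are grid points, so the column is integral.\<close>
    define y z where "y k = grid_floor k (p x0)" and "z k = y k + (1 / of_nat (Suc k)) *\<^sub>R axis j 1" for k
    have y: "y \<longlonglongrightarrow> p x0" unfolding y_def by (rule grid_floor_tendsto)
    have "z \<longlonglongrightarrow> p x0 + 0 *\<^sub>R axis j 1"
      unfolding z_def using LIMSEQ_Suc[OF lim_1_over_n] by (intro tendsto_intros y) simp
    then have z: "z \<longlonglongrightarrow> p x0" by simp
    have ev: "\<forall>\<^sub>F k in sequentially. B *v (w k - b) \<in> ?U" if "w \<longlonglongrightarrow> p x0" for w
    proof -
      have "(\<lambda>k. B *v (w k - b)) \<longlonglongrightarrow> B *v (p x0 - b)"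
        by (intro bounded_linear.tendsto[OF matrix_vector_mul_bounded_linear] tendsto_intros that)
      then show ?thesis using x0 by (intro topological_tendstoD) (auto simp: Bp)
    qed
    obtain k where k: "B *v (y k - b) \<in> ?U" "B *v (z k - b) \<in> ?U"
      using eventually_happens'[OF sequentially_bot eventually_conj[OF ev[OF y] ev[OF z]]] by blast
    have y_int: "of_nat (Suc k) * y k $ i \<in> \<int>" for i
      unfolding y_def by (rule grid_floor_Ints)
    have "of_nat (Suc k) * z k $ i \<in> \<int>" for i
    proof -
      have "of_nat (Suc k) * z k $ i = of_nat (Suc k) * y k $ i + axis j 1 $ i"
        by (simp add: z_def distrib_left del: of_nat_Suc)
      then show ?thesis using y_int[of i] by (simp add: axis_def)
    qed
    then have "B *v (z k - b) \<in> grid k" "B *v (y k - b) \<in> grid k"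
      using grid k y_int by blast+
    then have "of_nat (Suc k) * (B *v (z k - b)) $ i - of_nat (Suc k) * (B *v (y k - b)) $ i \<in> \<int>"
      unfolding grid_def by (intro Ints_diff) auto
    also have "of_nat (Suc k) * (B *v (z k - b)) $ i - of_nat (Suc k) * (B *v (y k - b)) $ i
        = of_nat (Suc k) * (B *v (z k - y k)) $ i"
      by (simp add: matrix_vector_mult_diff_distrib algebra_simps)
    also have "\<dots> = B $ i $ j"
      by (simp add: z_def matrix_vector_mult_scaleR matrix_vector_mult_basis column_def del: of_nat_Suc)
    finally show ?thesis .
  qed
  have "(- (B *v b)) $ i \<in> \<int>" for i
    unfolding matrix_vector_mult_def using B_int b by (auto intro!: Ints_sum Ints_mult)
  then have "integer_affine (\<lambda>y. (B *v y + - (B *v b)) $ i)" for i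
    by (intro integer_affine_matrix_component B_int)
  moreover have "B *v p x + - (B *v b) = x" for x
    using Bp[of x] by (simp add: matrix_vector_mult_diff_distrib)
  ultimately show ?thesis by (intro exI[of _ "\<lambda>y. B *v y + - (B *v b)"]) auto
qed

text \<open>The inverse \<open>g\<close> is continuous by compactness. It follows one of finitely
  many integer affine maps on a dense set of values of \<open>F\<close>, hence everywhere, since
  agreement with one of them is a closed condition.\<close>

lemma mcnaughton_inverse:
  "\<exists>d. (\<forall>i. mcnaughton_function (d i)) \<and> (\<forall>x\<in>unit_cube. \<forall>i. d i (F x) = x $ i)"
proof -
  define g where "g = the_inv_into unit_cube F"
  have gF: "g (F x) = x" if "x \<in> unit_cube" for x
    unfolding g_def using F_inj that by (rule the_inv_into_f_f)
  have g_cube: "g y \<in> unit_cube" and Fg: "F (g y) = y" if y: "y \<in> unit_cube" for y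
  proof -
    have "y \<in> F ` unit_cube" using y by (simp only: image_unit_cube)
    then obtain x where "y = F x" "x \<in> unit_cube" by (rule imageE)
    then show "g y \<in> unit_cube" "F (g y) = y" by (simp_all only: gF)
  qed
  have g_cont: "continuous_on unit_cube g"
    using continuous_on_inv_into[OF F_cont _ F_inj] image_unit_cube by (simp add: g_def)
  let ?K = "\<lambda>p. {x \<in> unit_cube. F x = p x}"
  \<comment> \<open>Only pieces followed on a nonempty open set are known to be invertible.\<close>
  let ?P = "{p \<in> P. interior (?K p) \<noteq> {}}"
  let ?Y = "\<Union>p\<in>P. interior (?K p)"
  have "\<forall>p\<in>?P. \<exists>q. (\<forall>i. integer_affine (\<lambda>y. q y $ i)) \<and> (\<forall>x. q (p x) = x)"
    using integer_affine_local_inverse by blast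
  from bchoice[OF this] obtain q
    where "\<forall>p\<in>?P. (\<forall>i. integer_affine (\<lambda>y. q p y $ i)) \<and> (\<forall>x. q p (p x) = x)" by blast
  then have q: "\<And>p i. p \<in> ?P \<Longrightarrow> integer_affine (\<lambda>y. q p y $ i)" "\<And>p x. p \<in> ?P \<Longrightarrow> q p (p x) = x"
    by blast+
  have vec_cont: "continuous_on X r" if "\<And>i. integer_affine (\<lambda>y. r y $ i)" for X r
    using continuous_on_vec_lambda[of X "\<lambda>i y. r y $ i"] integer_affine_continuous[OF that] by simp
  let ?T = "\<Union>p\<in>?P. {y \<in> unit_cube. g y = q p y}"
  have T: "closed ?T"
  proof (intro closed_UN ballI)
    fix p assume "p \<in> ?P"
    then show "closed {y \<in> unit_cube. g y = q p y}"
      by (intro closed_Collect_eq_on g_cont vec_cont q(1)) auto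
  qed (use P_fin in simp)
  have K_int: "x \<in> unit_cube" "F x = p x" if "x \<in> interior (?K p)" for x p
    using that interior_subset[of "?K p"] by auto
  have Y_cube: "?Y \<subseteq> unit_cube" using K_int(1) by blast
  have "interior unit_cube \<subseteq> closure (\<Union> (interior ` ?K ` P))"
  proof (rule open_subset_closure_Union_interior)
    show "closed S" if "S \<in> ?K ` P" for S
      using that P_int by (auto intro!: closed_Collect_eq_on F_cont vec_cont)
    have "unit_cube \<subseteq> \<Union> (?K ` P)" using P_cover by auto
    then show "interior unit_cube \<subseteq> \<Union> (?K ` P)" using interior_subset by (rule subset_trans[rotated])
  qed (use P_fin in auto)
  then have "closure (interior unit_cube) \<subseteq> closure ?Y"
    by (intro closure_minimal) (simp_all add: image_image)
  then have dense: "unit_cube \<subseteq> closure ?Y" using interior_unit_cube_dense by blast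
  \<comment> \<open>On \<open>?Y\<close> the inverse pieces \<open>q p\<close> undo
    \<open>F\<close>. Continuity of \<open>F\<close> and closedness of \<open>?T\<close> extend this
    to the closure, which contains the cube.\<close>
  have "F ` closure ?Y \<subseteq> ?T"
  proof (rule image_closure_subset[OF _ T])
    show "continuous_on (closure ?Y) F"
      using F_cont by (rule continuous_on_subset) (intro closure_minimal Y_cube closed_cbox)
    show "F ` ?Y \<subseteq> ?T"
    proof (intro image_subsetI)
      fix x assume "x \<in> ?Y"
      then obtain p where p: "p \<in> P" "x \<in> interior (?K p)" by blast
      then have "p \<in> ?P" by blast
      moreover have "g (F x) = q p (F x)"
        using q(2)[OF \<open>p \<in> ?P\<close>, of x] K_int[OF p(2)] gF[OF K_int(1)[OF p(2)]] by simp
      moreover have "F x \<in> unit_cube" using K_int(1)[OF p(2)] F_cube by (metis image_subset_iff)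
      ultimately show "F x \<in> ?T" by blast
    qed
  qed
  then have cover: "\<exists>p\<in>?P. g y = q p y" if "y \<in> unit_cube" for y
  proof -
    have "F (g y) \<in> F ` closure ?Y" using dense g_cube[OF that] by (intro imageI) (rule subsetD)
    with \<open>F ` closure ?Y \<subseteq> ?T\<close> have "F (g y) \<in> ?T" by (rule subsetD)
    then show ?thesis unfolding Fg[OF that] by blast
  qed
  show ?thesis
  proof (intro exI[of _ "\<lambda>i. \<lambda>y\<in>unit_cube. g y $ i"] conjI allI ballI)
    fix i
    have "continuous_on unit_cube (\<lambda>y\<in>unit_cube. g y $ i)"
      using g_cont by (subst continuous_on_cong[OF refl, where g = "\<lambda>y. g y $ i"])
        (auto intro!: continuous_intros)
    moreover have "(\<lambda>y\<in>unit_cube. g y $ i) \<in> unit_cube \<rightarrow>\<^sub>E {0..1}"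
      using g_cube by (auto simp: mem_box_cart)
    moreover have "\<forall>y\<in>unit_cube. \<exists>r\<in>(\<lambda>p y. q p y $ i) ` ?P. (\<lambda>y\<in>unit_cube. g y $ i) y = r y"
    proof
      fix y :: "real ^ 'n" assume y: "y \<in> unit_cube"
      obtain p where p: "p \<in> ?P" "g y = q p y" using cover[OF y] by (rule bexE)
      show "\<exists>r\<in>(\<lambda>p y. q p y $ i) ` ?P. (\<lambda>y\<in>unit_cube. g y $ i) y = r y"
        by (rule bexI[OF _ imageI[OF p(1)]]) (simp add: y p(2))
    qed
    moreover have "finite ((\<lambda>p y. q p y $ i) ` ?P)" using P_fin by simp
    moreover have "\<forall>r\<in>(\<lambda>p y. q p y $ i) ` ?P. integer_affine r" using q(1) by blast
    ultimately show "mcnaughton_function (\<lambda>y\<in>unit_cube. g y $ i)"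
      unfolding mcnaughton_function_def by (intro conjI exI[of _ "(\<lambda>p y. q p y $ i) ` ?P"])
  next
    fix x :: "real ^ 'n" and i assume "x \<in> unit_cube"
    then show "(\<lambda>y\<in>unit_cube. g y $ i) (F x) = x $ i"
      using F_cube by (subst restrict_apply') (auto simp: gF)
  qed
qed

end

section \<open>Separating subalgebras with as many generators as coordinates\<close>

lemma mcnaughton_projection:
  fixes i :: "'n :: finite"
  shows "mcnaughton_function (\<lambda>x\<in>unit_cube. x $ i)"
proof -
  have "continuous_on unit_cube (\<lambda>x\<in>unit_cube :: (real ^ 'n) set. x $ i)"
    by (subst continuous_on_cong[OF refl, where g = "\<lambda>x. x $ i"]) (auto intro!: continuous_intros)
  moreover have "integer_affine (\<lambda>x :: real ^ 'n. x $ i)"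
    unfolding integer_affine_def
    by (intro exI[of _ "axis i 1"] exI[of _ 0])
      (simp add: axis_def if_distrib[of of_int] if_distrib[of "\<lambda>c. c * _"] cong: if_cong)
  ultimately show ?thesis
    unfolding mcnaughton_function_def
    by (intro conjI exI[of _ "{\<lambda>x. x $ i}"]) (auto simp: mem_box_cart)
qed

lemma separating_generated_eq_carrier:
  fixes A :: "(real ^ 'n \<Rightarrow> real) set"
  assumes sub: "mv_subalgebra A mcnaughton_algebra"
    and gen: "mv_generated_by_n mcnaughton_algebra CARD('n) A" and sep: "separating A"
  shows "A = carrier mcnaughton_algebra"
proof -
  let ?M = "mcnaughton_algebra :: (real ^ 'n \<Rightarrow> real) mv_struct"
  obtain G where G: "G \<subseteq> carrier ?M" "finite G" "card G \<le> CARD('n)" "A = mv_generated ?M G"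
    using gen unfolding mv_generated_by_n_def by blast
  have GA: "G \<subseteq> A" using G(4) by (auto simp: mv_generated_def)
  \<comment> \<open>The generators are indexed by the coordinates, repeating one if there are too
    few; with no generators the zero function fills every place.\<close>
  obtain e :: "'n \<Rightarrow> real ^ 'n \<Rightarrow> real" where e: "range e \<subseteq> A" "G \<subseteq> range e"
  proof (cases "G = {}")
    case True
    then show ?thesis using that[of "\<lambda>_. \<lambda>_\<in>unit_cube. 0"] subalgebra_zero[OF sub] by auto
  next
    case False
    obtain N :: "'n set" where "card N = card G" using obtain_subset_with_card_n[OF G(3)] by metis
    then obtain h where h: "bij_betw h N G"
      using finite_same_card_bij[of N G] G(2) by auto
    obtain c where c: "c \<in> G" using False by blast
    show ?thesis
      using that[of "\<lambda>i. if i \<in> N then h i else c"] h c GA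
      by (auto simp: bij_betw_def)
  qed
  have eA: "e i \<in> A" for i using e(1) by blast
  define F where "F x = (\<chi> i. e i x)" for x
  have mc: "mcnaughton_function (e i)" for i using subalgebra_mcnaughton[OF sub eA] .
  have F_inj: "inj_on F unit_cube"
  proof (rule inj_onI, rule ccontr)
    fix x y :: "real ^ 'n"
    assume x: "x \<in> unit_cube" and y: "y \<in> unit_cube" and F: "F x = F y" and ne: "x \<noteq> y"
    \<comment> \<open>The functions that do not distinguish \<open>x\<close> from \<open>y\<close>
      form a subalgebra. If it contained the generators, it would contain \<open>A\<close>, against
      separation.\<close>
    let ?E = "{f \<in> carrier ?M. f x = f y}"
    have "mv_subalgebra ?E ?M"
      using mcnaughton_function_zero mcnaughton_function_neg mcnaughton_function_plus x y
      by (auto simp: mv_subalgebra_def mcnaughton_algebra_def)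
    moreover have "G \<subseteq> ?E"
      using e(2) G(1) F by (auto simp: F_def vec_eq_iff)
    ultimately have "A \<subseteq> ?E" using G(4) by (auto simp: mv_generated_def)
    then show False using sep x y ne unfolding separating_def by blast
  qed
  obtain Q where Q: "\<And>i. finite (Q i)" "\<And>i p. p \<in> Q i \<Longrightarrow> integer_affine p"
    and cover: "\<And>i x. x \<in> unit_cube \<Longrightarrow> \<exists>p\<in>Q i. e i x = p x"
    using mc unfolding mcnaughton_function_def by metis
  \<comment> \<open>Choosing one piece for each coordinate yields finitely many vector-valued pieces
    covering \<open>F\<close>.\<close>
  let ?P = "(\<lambda>s x. \<chi> i. s i x) ` PiE UNIV Q"
  have "\<exists>d. (\<forall>i. mcnaughton_function (d i)) \<and> (\<forall>x\<in>unit_cube. \<forall>i. d i (F x) = x $ i)"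
  proof (rule mcnaughton_inverse[OF _ F_inj])
    show "F ` unit_cube \<subseteq> unit_cube"
      using mcnaughton_function_range[OF mc] by (auto simp: F_def mem_box_cart)
    show "continuous_on unit_cube F"
      unfolding F_def using mc by (intro continuous_on_vec_lambda) (simp add: mcnaughton_function_def)
    show "finite ?P" using Q(1) by (intro finite_imageI finite_PiE) auto
    show "integer_affine (\<lambda>x. p x $ i)" if "p \<in> ?P" for p i
    proof -
      obtain s where s: "p = (\<lambda>x. \<chi> i. s i x)" "s i \<in> Q i"
        using \<open>p \<in> ?P\<close> by (auto simp: PiE_UNIV_domain)
      then show ?thesis using Q(2)[OF s(2)] by simp
    qed
    fix x :: "real ^ 'n" assume "x \<in> unit_cube"
    then have "\<forall>i. \<exists>p. p \<in> Q i \<and> e i x = p x" using cover by blast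
    from choice[OF this] obtain s where "\<And>i. s i \<in> Q i" "\<And>i. e i x = s i x" by blast
    then show "\<exists>p\<in>?P. F x = p x"
      by (intro bexI[of _ "\<lambda>x. \<chi> i. s i x"]) (auto simp: F_def PiE_UNIV_domain)
  qed
  then obtain d where d: "\<And>i. mcnaughton_function (d i)"
    and dF: "\<And>i x. x \<in> unit_cube \<Longrightarrow> d i (F x) = x $ i" by blast
  \<comment> \<open>Substituting the generators into a coordinate of the inverse map recovers the
    projection.\<close>
  have proj: "(\<lambda>x\<in>unit_cube. x $ i) \<in> A" for i
  proof -
    have "(\<lambda>x\<in>unit_cube. x $ i) = (\<lambda>x\<in>unit_cube. d i (\<chi> i. e i x))"
      using dF by (intro restrict_ext) (simp add: F_def)
    also have "\<dots> \<in> A" by (rule subalgebra_mcnaughton_comp[OF sub eA d])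
    finally show ?thesis .
  qed
  \<comment> \<open>The same substitution, now with the projections in place of the generators,
    returns \<open>f\<close> itself.\<close>
  have "f \<in> A" if "f \<in> carrier ?M" for f
  proof -
    have f: "mcnaughton_function f" using that by (simp add: mcnaughton_algebra_def)
    then have "f = (\<lambda>x\<in>unit_cube. f (\<chi> i. (\<lambda>x\<in>unit_cube. x $ i) x))"
      by (auto simp: mcnaughton_function_def PiE_def extensional_def fun_eq_iff)
    also have "\<dots> \<in> A" by (rule subalgebra_mcnaughton_comp[OF sub proj f])
    finally show ?thesis .
  qed
  then show ?thesis using sub by (auto simp: mv_subalgebra_def)
qed

section \<open>Epi-subalgebras are separating\<close>

text \<open>Test algebras must live on the type \<open>'b\<close>, so a subalgebra \<open>V\<close>
  of the real unit interval is copied there along \<open>\<iota>\<close>. Through its left inverse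
  \<open>r\<close> the axioms become identities between reals.\<close>

lemma mv_algebra_transported:
  fixes V :: "real set" and \<iota> :: "real \<Rightarrow> 'b"
  assumes V: "V \<subseteq> {0..1}" "0 \<in> V" "\<And>u. u \<in> V \<Longrightarrow> 1 - u \<in> V"
    "\<And>u v. u \<in> V \<Longrightarrow> v \<in> V \<Longrightarrow> min 1 (u + v) \<in> V"
    and \<iota>: "\<And>u. u \<in> V \<Longrightarrow> r (\<iota> u) = u"
  shows "mv_algebra \<lparr>carrier = \<iota> ` V, mv_plus = (\<lambda>a b. \<iota> (min 1 (r a + r b))),
    mv_neg = (\<lambda>a. \<iota> (1 - r a)), mv_zero = \<iota> 0\<rparr>" (is "mv_algebra ?C")
proof
  have rng: "0 \<le> u" "u \<le> 1" if "u \<in> V" for u using V(1) that by auto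
  note * = \<iota> V(2-4)
  fix a b c assume "a \<in> carrier ?C" "b \<in> carrier ?C" "c \<in> carrier ?C"
  then obtain u v w where [simp]: "a = \<iota> u" "b = \<iota> v" "c = \<iota> w" and uvw: "u \<in> V" "v \<in> V" "w \<in> V"
    by auto
  show "a \<oplus>\<^bsub>?C\<^esub> b \<oplus>\<^bsub>?C\<^esub> c = a \<oplus>\<^bsub>?C\<^esub> (b \<oplus>\<^bsub>?C\<^esub> c)"
    using uvw rng[OF uvw(1)] rng[OF uvw(2)] rng[OF uvw(3)]
    by (auto simp: * intro!: arg_cong[of _ _ \<iota>])
next
  have rng: "0 \<le> u" "u \<le> 1" if "u \<in> V" for u using V(1) that by auto
  note * = \<iota> V(2-4)
  fix a b assume "a \<in> carrier ?C" "b \<in> carrier ?C"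
  then obtain u v where [simp]: "a = \<iota> u" "b = \<iota> v" and uv: "u \<in> V" "v \<in> V" by auto
  show "\<sim>\<^bsub>?C\<^esub> (\<sim>\<^bsub>?C\<^esub> a \<oplus>\<^bsub>?C\<^esub> b) \<oplus>\<^bsub>?C\<^esub> b = \<sim>\<^bsub>?C\<^esub> (\<sim>\<^bsub>?C\<^esub> b \<oplus>\<^bsub>?C\<^esub> a) \<oplus>\<^bsub>?C\<^esub> a"
    using uv rng[OF uv(1)] rng[OF uv(2)]
    by (auto simp: * intro!: arg_cong[of _ _ \<iota>])
qed (use assms V(3)[OF V(2)] in \<open>auto simp: add.commute subset_iff min_absorb1 min_absorb2\<close>)

lemma epi_subalgebra_separating:
  fixes A :: "(real ^ 'n \<Rightarrow> real) set"
  assumes inf: "infinite (UNIV :: 'b set)"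
    and epi: "mv_epi_subalgebra TYPE('b) A mcnaughton_algebra"
  shows "separating A"
  unfolding separating_def
proof (intro ballI impI, rule ccontr)
  let ?M = "mcnaughton_algebra :: (real ^ 'n \<Rightarrow> real) mv_struct"
  fix x y :: "real ^ 'n"
  assume x: "x \<in> unit_cube" and y: "y \<in> unit_cube" and ne: "x \<noteq> y"
    and "\<not> (\<exists>f\<in>A. f x \<noteq> f y)"
  then have agree: "\<And>f. f \<in> A \<Longrightarrow> f x = f y" by blast
  \<comment> \<open>The type \<open>'b\<close> may be countable, so the two evaluations must share a countable range \<open>V\<close>.\<close>
  define w :: "(int ^ 'n) \<times> (int ^ 'n) \<times> int \<Rightarrow> real" where
    "w = (\<lambda>(a, c, b). (\<Sum>i\<in>UNIV. of_int (a $ i) * x $ i) + (\<Sum>i\<in>UNIV. of_int (c $ i) * y $ i) + of_int b)"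
  have w_add: "w (a, c, b) + w (a', c', b') = w (a + a', c + c', b + b')"
    and w_minus: "1 - w (a, c, b) = w (- a, - c, 1 - b)" and w_int: "w (0, 0, b) = of_int b" for a c b a' c' b'
    by (simp_all add: w_def sum.distrib sum_negf algebra_simps)
  \<comment> \<open>The range of \<open>w\<close> is the additive group generated by 1 and the
    coordinates of \<open>x\<close> and \<open>y\<close>. Its trace on the unit interval is closed
    under the MV-operations and contains all values of McNaughton functions at \<open>x\<close> and
    \<open>y\<close>.\<close>
  define V where "V = range w \<inter> {0..1}"
  have "countable V" unfolding V_def by (intro countable_Int1) simp
  then obtain \<kappa> :: "real \<Rightarrow> nat" where \<kappa>: "inj_on \<kappa> V" by (auto elim: countableE)
  obtain j :: "nat \<Rightarrow> 'b" where j: "inj j" using inf by (auto simp: infinite_iff_countable_subset)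
  define \<iota> where "\<iota> = j \<circ> \<kappa>"
  define r where "r = the_inv_into V \<iota>"
  have \<iota>_inj: "inj_on \<iota> V" unfolding \<iota>_def using \<kappa> j by (metis comp_inj_on inj_on_subset subset_UNIV)
  then have \<iota>: "r (\<iota> u) = u" if "u \<in> V" for u unfolding r_def using that by (rule the_inv_into_f_f)
  define C where "C = \<lparr>carrier = \<iota> ` V, mv_plus = (\<lambda>a b. \<iota> (min 1 (r a + r b))),
    mv_neg = (\<lambda>a. \<iota> (1 - r a)), mv_zero = \<iota> 0\<rparr>"
  have V01: "0 \<in> V" "1 \<in> V"
    using w_int[of 0] w_int[of 1] by (auto simp: V_def intro: range_eqI[OF sym])
  have "mv_algebra C"
    unfolding C_def
  proof (rule mv_algebra_transported)
    show "1 - u \<in> V" if "u \<in> V" for u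
      using that w_minus by (auto simp: V_def)
    show "min 1 (u + v) \<in> V" if "u \<in> V" "v \<in> V" for u v
    proof (cases "u + v \<le> 1")
      case True
      then show ?thesis using that w_add by (auto simp: V_def min_absorb2)
    next
      case False
      then show ?thesis using V01(2) by simp
    qed
  qed (use V01 \<iota> in \<open>auto simp: V_def\<close>)
  have val: "f z \<in> V" if f: "mcnaughton_function f" and z: "z = x \<or> z = y" for f z
  proof -
    have zc: "z \<in> unit_cube" using z x y by blast
    obtain p where p: "integer_affine p" "f z = p z"
      using f zc unfolding mcnaughton_function_def by blast
    then obtain a b where "f z = (\<Sum>i\<in>UNIV. of_int (a $ i) * z $ i) + of_int b"
      unfolding integer_affine_def by metis
    then have "f z = w (a, 0, b) \<or> f z = w (0, a, b)" using z by (auto simp: w_def)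
    then show ?thesis using mcnaughton_function_range[OF f zc] by (auto simp: V_def)
  qed
  have hom: "(\<lambda>f. \<iota> (f z)) \<in> mv_hom ?M C" if "z = x \<or> z = y" for z
    using val[OF _ that] that x y
    by (auto simp: mv_hom_def C_def mcnaughton_algebra_def \<iota>)
  have eq: "\<iota> (f x) = \<iota> (f y)" if "f \<in> carrier ?M" for f
  proof -
    have "\<forall>h\<in>mv_hom ?M C. \<forall>k\<in>mv_hom ?M C.
        (\<forall>a\<in>A. h a = k a) \<longrightarrow> (\<forall>b\<in>carrier ?M. h b = k b)"
      using epi \<open>mv_algebra C\<close> unfolding mv_epi_subalgebra_def by blast
    from bspec[OF bspec[OF this hom[of x]] hom[of y]]
    have "(\<forall>a\<in>A. \<iota> (a x) = \<iota> (a y)) \<longrightarrow> (\<forall>b\<in>carrier ?M. \<iota> (b x) = \<iota> (b y))" by simp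
    moreover have "\<forall>a\<in>A. \<iota> (a x) = \<iota> (a y)" by (intro ballI arg_cong[of _ _ \<iota>] agree)
    ultimately show ?thesis using that by blast
  qed
  \<comment> \<open>The two evaluations agree on the projections as well, which forces
    \<open>x\<close> and \<open>y\<close> to coincide.\<close>
  have "x $ i = y $ i" for i
  proof -
    let ?f = "\<lambda>x\<in>unit_cube. x $ i"
    have f: "mcnaughton_function ?f" by (rule mcnaughton_projection)
    then have "\<iota> (?f x) = \<iota> (?f y)" by (intro eq) (simp del: restrict_apply add: mcnaughton_algebra_def)
    then have "?f x = ?f y" using val[OF f, of x] val[OF f, of y] \<iota>_inj by (metis inj_onD)
    then show ?thesis using x y by simp
  qed
  then show False using ne by (simp add: vec_eq_iff)
qed

theorem theorem4p6:
  fixes A :: "(real ^ 'n \<Rightarrow> real) set"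
  assumes "mv_subalgebra A mcnaughton_algebra"
    and "mv_generated_by_n mcnaughton_algebra CARD('n) A"
  shows "(separating A \<longrightarrow> A = carrier mcnaughton_algebra) \<and>
    (infinite (UNIV :: 'b set) \<longrightarrow> mv_epi_subalgebra TYPE('b) A mcnaughton_algebra \<longrightarrow>
       A = carrier mcnaughton_algebra)"
proof (intro conjI impI)
  show "A = carrier mcnaughton_algebra" if "separating A"
    using assms that by (rule separating_generated_eq_carrier)
  then show "A = carrier mcnaughton_algebra"
    if "infinite (UNIV :: 'b set)" "mv_epi_subalgebra TYPE('b) A mcnaughton_algebra"
    using epi_subalgebra_separating[OF that] by blast
qed

end
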